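(* Any $r$-dimensional completely entangled subspace of $\mathbb{C}^m\otimes\mathbb{C}^n$ with $r<(m-1)(n-1)$ is a subspace of an $(r+1)$-dimensional completely entangled subspace of $\mathbb{C}^m\otimes\mathbb{C}^n$.
   Context: A (complex linear) subspace of $\mathbb{C}^m\otimes\mathbb{C}^n$ is a completely entangled subspace (CES) if it contains no nonzero product vector $|e\rangle\otimes|f\rangle$ with $|e\rangle\in\mathbb{C}^m$, $|f\rangle\in\mathbb{C}^n$. *)

theory Defs
  imports "HOL-Analysis.Analysis"
begin

text \<open>The tensor product of \<open>complex ^ 'm\<close> and \<open>complex ^ 'n\<close> is modelled in coordinates as
  \<open>complex ^ ('m \<times> 'n)\<close>; the standard basis tensor \<open>e\<^sub>i \<otimes> f\<^sub>j\<close> is the axis vector at \<open>(i, j)\<close>.\<close>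

definition tensor_vec :: "complex ^ 'm \<Rightarrow> complex ^ 'n \<Rightarrow> complex ^ ('m \<times> 'n)" where
  "tensor_vec e f = (\<chi> p. e $ fst p * f $ snd p)"

text \<open>\<open>vec.subspace\<close> and \<open>vec.dim\<close> refer to the scalar multiplication \<open>(*s)\<close>, hence here to complex
  linear structure, unlike the unqualified \<open>subspace\<close> and \<open>dim\<close>, which are real.\<close>

definition completely_entangled :: "(complex ^ ('m::finite \<times> 'n::finite)) set \<Rightarrow> bool" where
  "completely_entangled S \<longleftrightarrow>
     vec.subspace S \<and> (\<forall>e f. tensor_vec e f \<in> S \<longrightarrow> tensor_vec e f = 0)"

end

theory Submission
  imports Defs
begin

text \<open>The vectors \<open>v\<close> for which \<open>S + \<complex> v\<close> contains a nonzero product vector outside \<open>S\<close> are of the form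
  \<open>s + e \<otimes> f\<close> with \<open>s \<in> S\<close> and \<open>e \<noteq> 0\<close>. Normalising one coordinate of \<open>e\<close> to \<open>1\<close>, they lie in finitely
  many smooth images of real vector spaces of dimension \<open>2 (r + (m - 1) + n) < 2 m n\<close>, hence in a
  Lebesgue null set. Any \<open>v\<close> outside this null set extends \<open>S\<close>.\<close>

text \<open>The domain and the target may be different spaces. Since \<open>dim V\<close> is below
  the target dimension, \<open>V\<close> is an isometric copy of a proper subspace \<open>W\<close>
  of the target. \<open>W\<close> is null, and composing with the isometry leaves a differentiable
  map between spaces of equal dimension, which preserves null sets.\<close>

lemma negligible_differentiable_image_subspace:
  fixes f :: "'a::euclidean_space \<Rightarrow> 'b::euclidean_space"
  assumes V: "subspace V" and d: "dim V < DIM('b)" and f: "f differentiable_on V"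
  shows "negligible (f ` V)"
proof -
  obtain W :: "'b set" where W: "subspace W" "dim W = dim V"
    using choose_subspace_of_subspace[of "dim V" "UNIV :: 'b set"] d by (auto simp: dim_UNIV)
  obtain L where L: "linear L" "L ` W = V"
    using isometries_subspaces[OF W(1) V] W(2) by metis
  have "(f \<circ> L) differentiable_on W"
    unfolding o_def
    by (rule differentiable_on_compose) (use f L in \<open>auto intro: linear_imp_differentiable_on\<close>)
  moreover have "negligible W"
    using W d by (intro negligible_lowdim) simp
  ultimately have "negligible ((f \<circ> L) ` W)"
    by (intro negligible_differentiable_image_negligible order_refl)
  then show ?thesis
    by (simp only: image_comp[symmetric] L(2))
qed

lemma scaleR_conv_vector_scalar_mult:
  fixes x :: "complex ^ 'k"
  shows "a *\<^sub>R x = complex_of_real a *s x"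
  by (simp add: vec_eq_iff scaleR_conv_of_real[where 'a = complex])

lemma vec_subspace_imp_subspace:
  fixes S :: "(complex ^ 'k) set"
  assumes "vec.subspace S"
  shows "subspace S"
  using assms by (auto simp: subspace_def vec.subspace_def scaleR_conv_vector_scalar_mult)

text \<open>Splitting each complex coefficient into real and imaginary parts shows that
  \<open>B\<close> together with its multiples by the imaginary unit spans \<open>vec.span B\<close>
  over the reals.\<close>

lemma dim_vec_span_le:
  fixes B :: "(complex ^ 'k::finite) set"
  assumes "finite B"
  shows "dim (vec.span B) \<le> 2 * card B"
proof -
  let ?C = "B \<union> (\<lambda>b. \<i> *s b) ` B"
  have "vec.span B \<subseteq> span ?C"
  proof
    fix x assume "x \<in> vec.span B"
    then obtain c where x: "x = (\<Sum>b\<in>B. c b *s b)"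
      using vec.span_finite[OF assms] by auto
    have "c b *s b \<in> span ?C" if "b \<in> B" for b
    proof -
      have "Re (c b) *\<^sub>R b + Im (c b) *\<^sub>R (\<i> *s b) \<in> span ?C"
        using that by (intro span_add span_scale span_base) auto
      also have "Re (c b) *\<^sub>R b + Im (c b) *\<^sub>R (\<i> *s b) = c b *s b"
        by (simp add: vec_eq_iff complex_eq_iff)
      finally show ?thesis .
    qed
    then show "x \<in> span ?C"
      unfolding x by (rule span_sum)
  qed
  then have "dim (vec.span B) \<le> card ?C"
    using assms by (intro dim_le_card) auto
  also have "\<dots> \<le> card B + card B"
    using card_Un_le[of B] card_image_le[OF assms] by (meson add_left_mono order_trans)
  finally show ?thesis by simp
qed

lemma dim_vec_subspace_le:
  fixes S :: "(complex ^ 'k::finite) set"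
  assumes "vec.subspace S"
  shows "dim S \<le> 2 * vec.dim S"
proof -
  obtain B where B: "B \<subseteq> S" "vec.independent B" "S \<subseteq> vec.span B" "card B = vec.dim S"
    using vec.basis_exists by blast
  then have "dim S \<le> dim (vec.span B)"
    by (intro dim_subset)
  then show ?thesis
    using dim_vec_span_le[OF vec.finiteI_independent[OF B(2)]] B(4) by simp
qed

lemma dim_coordinate_hyperplane_le:
  fixes i :: "'k::finite"
  shows "dim {x :: complex ^ 'k. x $ i = 0} \<le> 2 * (CARD('k) - 1)"
proof -
  let ?B = "(\<lambda>j. axis j 1 :: complex ^ 'k) ` (UNIV - {i})"
  have "{x. x $ i = 0} \<subseteq> vec.span ?B"
  proof
    fix x :: "complex ^ 'k" assume "x \<in> {x. x $ i = 0}"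
    then have "x = (\<Sum>j\<in>UNIV - {i}. x $ j *s axis j 1)"
      using basis_expansion[of x] sum.remove[of UNIV i "\<lambda>j. x $ j *s axis j 1"] by simp
    also have "\<dots> \<in> vec.span ?B"
      by (intro vec.span_sum vec.span_scale vec.span_base imageI)
    finally show "x \<in> vec.span ?B" .
  qed
  then have "dim {x :: complex ^ 'k. x $ i = 0} \<le> dim (vec.span ?B)"
    by (rule dim_subset)
  also have "\<dots> \<le> 2 * card ?B"
    by (rule dim_vec_span_le) simp
  also have "\<dots> \<le> 2 * (CARD('k) - 1)"
    using card_image_le[of "UNIV - {i}" "\<lambda>j. axis j 1 :: complex ^ 'k"] by simp
  finally show ?thesis .
qed

lemma tensor_vec_scale_left: "tensor_vec (c *s e) f = c *s tensor_vec e f"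
  by (simp add: tensor_vec_def vec_eq_iff)

lemma tensor_vec_0_right [simp]: "tensor_vec e 0 = 0"
  by (simp add: tensor_vec_def vec_eq_iff)

lemma bilinear_tensor_vec:
  "bilinear (tensor_vec :: complex ^ 'm::finite \<Rightarrow> complex ^ 'n::finite \<Rightarrow> _)"
  by (auto simp: bilinear_def tensor_vec_def vec_eq_iff algebra_simps intro!: linearI)

text \<open>Fixing \<open>e $ i = 1\<close> removes the freedom of moving a scalar between
  \<open>e\<close> and \<open>f\<close>, which saves one complex parameter.\<close>

definition product_translates ::
  "(complex ^ ('m::finite \<times> 'n::finite)) set \<Rightarrow> 'm \<Rightarrow> (complex ^ ('m \<times> 'n)) set" where
  "product_translates S i = {s + tensor_vec e f | s e f. s \<in> S \<and> e $ i = 1}"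

lemma negligible_product_translates:
  fixes S :: "(complex ^ ('m::finite \<times> 'n::finite)) set"
  assumes S: "vec.subspace S" and r: "vec.dim S < (CARD('m) - 1) * (CARD('n) - 1)"
  shows "negligible (product_translates S i)"
proof -
  define H where "H = {x :: complex ^ 'm. x $ i = 0}"
  define V where "V = S \<times> H \<times> (UNIV :: (complex ^ 'n) set)"
  \<comment> \<open>Shifting by \<open>axis i 1\<close> turns the affine condition
    \<open>e $ i = 1\<close> into the linear one defining \<open>H\<close>, so the parameter domain
    \<open>V\<close> is a subspace.\<close>
  define g where "g = (\<lambda>(s, e, f). s + tensor_vec (axis i 1 + e) f :: complex ^ ('m \<times> 'n))"
  have sub: "subspace S" "subspace H"
    using vec_subspace_imp_subspace[OF S] by (auto simp: H_def subspace_def)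
  have V: "subspace V"
    unfolding V_def by (intro subspace_Times sub subspace_UNIV)
  have "dim V = dim S + (dim H + CARD('n) * 2)"
    unfolding V_def using sub by (simp add: dim_Times subspace_Times dim_UNIV)
  also have "\<dots> \<le> 2 * vec.dim S + (2 * (CARD('m) - 1) + CARD('n) * 2)"
    unfolding H_def by (intro add_mono dim_vec_subspace_le[OF S] dim_coordinate_hyperplane_le order_refl)
  \<comment> \<open>With m = a + 1 and n = b + 1, r < ab gives r + a + (b + 1) < (a + 1)(b + 1). At
    r = ab - 1 the two sides differ by exactly 1, so the parameter saved by the normalisation is
    essential.\<close>
  also have "\<dots> < 2 * (CARD('m) * CARD('n))"
  proof -
    obtain a b where "CARD('m) = Suc a" "CARD('n) = Suc b"
      by (metis not0_implies_Suc zero_less_card_finite less_numeral_extra(3))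
    then show ?thesis using r by simp
  qed
  also have "\<dots> = DIM(complex ^ ('m \<times> 'n))"
    by simp
  finally have d: "dim V < DIM(complex ^ ('m \<times> 'n))" .
  have "g differentiable_on V"
  proof -
    \<comment> \<open>This provides the product rule \<open>FDERIV\<close> for
      \<open>tensor_vec\<close>.\<close>
    interpret bounded_bilinear "tensor_vec :: complex ^ 'm \<Rightarrow> complex ^ 'n \<Rightarrow> _"
      using bilinear_tensor_vec by (simp add: bilinear_conv_bounded_bilinear)
    have "\<exists>D. (g has_derivative D) (at x within V)" for x
      unfolding g_def case_prod_beta by (rule exI) (rule derivative_intros FDERIV)+
    then show ?thesis
      by (simp add: differentiable_on_def differentiable_def)
  qed
  then have "negligible (g ` V)"
    by (rule negligible_differentiable_image_subspace[OF V d])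
  moreover have "product_translates S i \<subseteq> g ` V"
  proof
    fix x assume "x \<in> product_translates S i"
    then obtain s e f where x: "x = s + tensor_vec e f" "s \<in> S" "e $ i = 1"
      by (auto simp: product_translates_def)
    then have "x = g (s, e - axis i 1, f)" "(s, e - axis i 1, f) \<in> V"
      by (auto simp: g_def V_def H_def)
    then show "x \<in> g ` V" by blast
  qed
  ultimately show ?thesis
    by (rule negligible_subset)
qed

text \<open>The scalar \<open>e $ i\<close> can be moved from \<open>e\<close> to \<open>f\<close>
  without changing the tensor.\<close>

lemma mem_product_translates:
  assumes "s \<in> S" "e $ i \<noteq> 0"
  shows "s + tensor_vec e f \<in> product_translates S i"
proof -
  have "tensor_vec e f = tensor_vec (inverse (e $ i) *s e) ((e $ i) *s f)"
    using assms by (simp add: tensor_vec_def vec_eq_iff)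
  moreover have "(inverse (e $ i) *s e) $ i = 1"
    using assms by simp
  ultimately show ?thesis
    using assms(1) unfolding product_translates_def by (intro CollectI exI conjI) auto
qed

theorem lemma2:
  fixes S :: "(complex ^ ('m::finite \<times> 'n::finite)) set" and r :: nat
  assumes "completely_entangled S"
    and "vec.dim S = r"
    and "r < (CARD('m) - 1) * (CARD('n) - 1)"
  shows "\<exists>T :: (complex ^ ('m \<times> 'n)) set.
           completely_entangled T \<and> vec.dim T = r + 1 \<and> S \<subseteq> T"
proof -
  have S: "vec.subspace S"
    and ent: "\<And>e f. tensor_vec e f \<in> S \<Longrightarrow> tensor_vec e f = 0"
    using assms(1) by (auto simp: completely_entangled_def)
  have "negligible (\<Union>i. product_translates S i)"
    using negligible_product_translates[OF S] assms by (intro negligible_Union) auto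
  then obtain v where v: "\<And>i. v \<notin> product_translates S i"
    using non_negligible_UNIV by (metis UNIV_eq_I UN_I UNIV_I)
  \<comment> \<open>Taking the second tensor factor to be 0 shows that \<open>S\<close> itself lies
    in each set of translates; \<open>undefined\<close> is just some index.\<close>
  have "v \<notin> S"
    using v mem_product_translates[of v S "axis undefined 1" undefined 0] by auto
  have span: "vec.span S = S"
    using S by (rule vec.span_eq_iff[THEN iffD2])
  let ?T = "vec.span (insert v S)"
  have "tensor_vec e f = 0" if T: "tensor_vec e f \<in> ?T" for e f
  proof (rule ccontr)
    assume nz: "tensor_vec e f \<noteq> 0"
    obtain c where c: "tensor_vec e f - c *s v \<in> S"
      using T by (auto simp: vec.span_breakdown_eq span)
    \<comment> \<open>For c = 0 the nonzero product vector would already lie in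
      \<open>S\<close>.\<close>
    have "c \<noteq> 0"
      using c ent nz by auto
    obtain i where i: "e $ i \<noteq> 0"
      using nz by (auto simp: tensor_vec_def vec_eq_iff)
    \<comment> \<open>Solving for \<open>v\<close> exhibits it as an element of \<open>S\<close>
      plus a product vector, which the choice of \<open>v\<close> excludes.\<close>
    have "- inverse c *s (tensor_vec e f - c *s v) + tensor_vec (inverse c *s e) f = v"
      using \<open>c \<noteq> 0\<close> by (simp add: tensor_vec_scale_left vec.scale_right_diff_distrib)
    moreover have "- inverse c *s (tensor_vec e f - c *s v) \<in> S"
      using S c by (rule vec.subspace_scale)
    moreover have "(inverse c *s e) $ i \<noteq> 0"
      using i \<open>c \<noteq> 0\<close> by simp
    ultimately have "v \<in> product_translates S i"
      by (metis mem_product_translates)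
    with v show False by blast
  qed
  then have "completely_entangled ?T"
    by (simp add: completely_entangled_def)
  moreover have "vec.dim ?T = r + 1"
    using \<open>v \<notin> S\<close> assms(2) by (simp add: vec.dim_insert span)
  moreover have "S \<subseteq> ?T"
    using vec.span_superset by blast
  ultimately show ?thesis by blast
qed

end
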